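(* Let $\mathcal{X}\subseteq\mathbb{R}^{n_1}\times\mathbb{R}^{n_2}$ be open and consider a port-Hamiltonian system with state $x=(x_1,x_2)\in\mathcal{X}$, Hamiltonian $H:\mathcal{X}\to\mathbb{R}$, and two ports $(u_1,y_1)$, $(u_2,y_2)$, of the form $$ \begin{aligned} \dot{x}_1 &= J_1(x_1,x_2)e_1-\mathcal{R}_1(x_1,x_2,e_1)+G_1u_1, & e_1&=\frac{\partial H}{\partial x_1}(x_1,x_2),\\ \dot{x}_2 &= J_2(x_1,x_2)e_2-\mathcal{R}_2(x_1,x_2,e_2)+G_2(x_1,x_2)u_2, & e_2&=\frac{\partial H}{\partial x_2}(x_1,x_2),\\ y_1&=G_1^Te_1,\qquad y_2=G_2^T(x_1,x_2)e_2, && \end{aligned} $$ where $J_1(x),J_2(x)$ are skew-symmetric for all $x\in\mathcal{X}$, where $e_1^T\mathcal{R}_1(x,e_1)\ge 0$ and $e_2^T\mathcal{R}_2(x,e_2)\ge 0$ for all $x\in\mathcal{X}$ and all vectors $e_1\in\mathbb{R}^{n_1}$, $e_2\in\mathbb{R}^{n_2}$, and where $G_1$ is a constant invertible square matrix. Assume the partial Legendre transform $H_1^*(e_1,x_2)$ of $H$ with respect to $x_1$ is well defined (see context). Then, for every constant vector $\bar y_1$ and every trajectory of the system along which $y_1(t)=\bar y_1$ for all $t$, also $e_1(t)=\bar e_1$ is constant in $t$, and along the trajectory $$\frac{d}{dt}H_1^*(\bar e_1,x_2)\le y_2^Tu_2 .$$ Consequently, for any constant $\bar y_1$, the system constrained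 by $y_1=\bar y_1$ is cyclo-passive at the second port $(u_2,y_2)$, with (possibly indefinite) storage function $x_2\mapsto H_1^*(\bar e_1,x_2)$.
   Context: Dimensions and regularity: $u_1,y_1\in\mathbb{R}^{n_1}$ (so $G_1$ is $n_1\times n_1$), $u_2,y_2\in\mathbb{R}^{m_2}$, $G_2(x)$ is an $n_2\times m_2$ matrix. $H$ is twice continuously differentiable; $J_i,\mathcal{R}_i,G_2$ are continuous. Gradients $\frac{\partial H}{\partial x_i}$ are column vectors. A trajectory on a time interval consists of input functions $u_1,u_2$ and a state function $x(\cdot)$ with values in $\mathcal{X}$ satisfying the differential equations. One may take $x$ absolutely continuous and $u_1,u_2$ locally integrable, with differential (in)equalities understood for almost all $t$. Partial Legendre transform: it is assumed that the Hessian $\frac{\partial^2H}{\partial x_1^2}(x_1,x_2)$ has full rank everywhere and that $x_1$ can be expressed as a function $x_1=x_1(e_1,x_2)$ by solving $e_1=\frac{\partial H}{\partial x_1}(x_1,x_2)$; that is, the map $(x_1,x_2)\mapsto\left(\frac{\partial H}{\partial x_1}(x_1,x_2),x_2\right)$ is injective on $\mathcal{X}$. Then, on the image of this map, $$H_1^*(e_1,x_2):=H(x_1,x_2)-e_1^Tx_1,\qquad e_1=\frac{\partial H}{\partial x_1}(x_1,x_2),$$ where $x_1=x_1(e_1,x_2)$ is substituted on the right-hand side. Cyclo-passivity with storage function: the constrained system is cyclo-passive at the port $(u_2,y_2)$ if $\int_{t_1}^{t_2}y_2(t)^Tu_2(t)\,dt\ge 0$ for all $t_1\le t_2$ and all trajectories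 satisfying the constraint $y_1(t)=\bar y_1$ for all $t$, with $x(t_1)=x(t_2)$. A function $S$ of the state (not required to be nonnegative or bounded below) is a storage function if $S(x(t_2))-S(x(t_1))\le\int_{t_1}^{t_2}y_2(t)^Tu_2(t)\,dt$ for all $t_1\le t_2$ and all such constrained trajectories (not necessarily with $x(t_1)=x(t_2)$). *)

theory Defs
  imports "HOL-Analysis.Analysis"
begin

text \<open>Partial gradients (column vectors) and the Hessian with respect to the first variable.\<close>

definition grad1 :: "('a::real_inner \<times> 'b::real_inner \<Rightarrow> real) \<Rightarrow> 'a \<times> 'b \<Rightarrow> 'a" where
  "grad1 H x = (THE g. GDERIV (\<lambda>z. H (z, snd x)) (fst x) :> g)"

definition grad2 :: "('a::real_inner \<times> 'b::real_inner \<Rightarrow> real) \<Rightarrow> 'a \<times> 'b \<Rightarrow> 'b" where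
  "grad2 H x = (THE g. GDERIV (\<lambda>z. H (fst x, z)) (snd x) :> g)"

definition hessian1 :: "((real^'n) \<times> 'b::real_inner \<Rightarrow> real) \<Rightarrow> (real^'n) \<times> 'b \<Rightarrow> real^'n^'n" where
  "hessian1 H x = jacobian (\<lambda>z. grad1 H (z, snd x)) (at (fst x))"

text \<open>Twice continuous (Frechet) differentiability; meant for open sets \<open>X\<close>.\<close>

definition C2_on :: "'a::real_normed_vector set \<Rightarrow> ('a \<Rightarrow> real) \<Rightarrow> bool" where
  "C2_on X f \<longleftrightarrow>
     (\<exists>(D :: 'a \<Rightarrow> 'a \<Rightarrow>\<^sub>L real) (D2 :: 'a \<Rightarrow> 'a \<Rightarrow>\<^sub>L 'a \<Rightarrow>\<^sub>L real).
        (\<forall>x\<in>X. (f has_derivative blinfun_apply (D x)) (at x)) \<and>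
        (\<forall>x\<in>X. (D has_derivative blinfun_apply (D2 x)) (at x)) \<and>
        continuous_on X D2)"

text \<open>The standing assumption on the partial Legendre transform, and the transform itself. The
  value of the latter is meaningful only for \<open>(e1, x2)\<close> in the image of
  \<open>(x1, x2) \<mapsto> (grad1 H (x1, x2), x2)\<close> on \<open>X\<close>.\<close>

definition partial_legendre_wf ::
    "((real^'n) \<times> 'b::real_inner) set \<Rightarrow> ((real^'n) \<times> 'b \<Rightarrow> real) \<Rightarrow> bool" where
  "partial_legendre_wf X H \<longleftrightarrow>
     (\<forall>x\<in>X. rank (hessian1 H x) = CARD('n)) \<and>
     inj_on (\<lambda>x. (grad1 H x, snd x)) X"

definition partial_legendre ::
    "('a::real_inner \<times> 'b::real_inner) set \<Rightarrow> ('a \<times> 'b \<Rightarrow> real) \<Rightarrow> 'a \<Rightarrow> 'b \<Rightarrow> real" where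
  "partial_legendre X H e1 x2 =
     (let x1 = (THE x1. (x1, x2) \<in> X \<and> grad1 H (x1, x2) = e1)
      in H (x1, x2) - e1 \<bullet> x1)"

text \<open>Absolute continuity in the epsilon-delta sense over finite families of nonoverlapping
  compact intervals contained in \<open>T\<close>, and its local version.\<close>

definition abs_continuous_on :: "real set \<Rightarrow> (real \<Rightarrow> 'a::real_normed_vector) \<Rightarrow> bool" where
  "abs_continuous_on T f \<longleftrightarrow>
     (\<forall>\<epsilon>>0. \<exists>\<delta>>0. \<forall>d s. d division_of s \<and> s \<subseteq> T \<and> (\<Sum>k\<in>d. Sup k - Inf k) < \<delta> \<longrightarrow>
        (\<Sum>k\<in>d. norm (f (Sup k) - f (Inf k))) < \<epsilon>)"

definition loc_abs_continuous_on :: "real set \<Rightarrow> (real \<Rightarrow> 'a::real_normed_vector) \<Rightarrow> bool" where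
  "loc_abs_continuous_on T f \<longleftrightarrow> (\<forall>a b. {a..b} \<subseteq> T \<longrightarrow> abs_continuous_on {a..b} f)"

definition loc_integrable_on :: "real set \<Rightarrow> (real \<Rightarrow> 'a::euclidean_space) \<Rightarrow> bool" where
  "loc_integrable_on T f \<longleftrightarrow> (\<forall>a b. {a..b} \<subseteq> T \<longrightarrow> f absolutely_integrable_on {a..b})"

text \<open>Trajectories on a time interval \<open>T\<close> (open or closed, bounded or not): the differential
  equations hold almost everywhere on \<open>T\<close>, the output equations everywhere on \<open>T\<close>.\<close>

definition ph_trajectory ::
    "((real^'n1) \<times> (real^'n2)) set \<Rightarrow> ((real^'n1) \<times> (real^'n2) \<Rightarrow> real) \<Rightarrow>
     ((real^'n1) \<times> (real^'n2) \<Rightarrow> real^'n1^'n1) \<Rightarrow>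
     ((real^'n1) \<times> (real^'n2) \<Rightarrow> real^'n2^'n2) \<Rightarrow>
     ((real^'n1) \<times> (real^'n2) \<Rightarrow> real^'n1 \<Rightarrow> real^'n1) \<Rightarrow>
     ((real^'n1) \<times> (real^'n2) \<Rightarrow> real^'n2 \<Rightarrow> real^'n2) \<Rightarrow>
     real^'n1^'n1 \<Rightarrow> ((real^'n1) \<times> (real^'n2) \<Rightarrow> real^'m2^'n2) \<Rightarrow>
     real set \<Rightarrow> (real \<Rightarrow> (real^'n1) \<times> (real^'n2)) \<Rightarrow>
     (real \<Rightarrow> real^'n1) \<Rightarrow> (real \<Rightarrow> real^'n1) \<Rightarrow> (real \<Rightarrow> real^'m2) \<Rightarrow> (real \<Rightarrow> real^'m2) \<Rightarrow> bool" where
  "ph_trajectory X H J1 J2 R1 R2 G1 G2 T x u1 y1 u2 y2 \<longleftrightarrow>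
     is_interval T \<and> x ` T \<subseteq> X \<and> loc_abs_continuous_on T x \<and>
     loc_integrable_on T u1 \<and> loc_integrable_on T u2 \<and>
     (AE t in lebesgue. t \<in> T \<longrightarrow>
        ((\<lambda>s. fst (x s)) has_vector_derivative
           (J1 (x t) *v grad1 H (x t) - R1 (x t) (grad1 H (x t)) + G1 *v u1 t)) (at t within T)) \<and>
     (AE t in lebesgue. t \<in> T \<longrightarrow>
        ((\<lambda>s. snd (x s)) has_vector_derivative
           (J2 (x t) *v grad2 H (x t) - R2 (x t) (grad2 H (x t)) + G2 (x t) *v u2 t)) (at t within T)) \<and>
     (\<forall>t\<in>T. y1 t = transpose G1 *v grad1 H (x t)) \<and>
     (\<forall>t\<in>T. y2 t = transpose (G2 (x t)) *v grad2 H (x t))"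

text \<open>A behaviour \<open>B T x u y\<close> says that \<open>x\<close>, \<open>u\<close>, \<open>y\<close> are the state, input and output of an
  admissible trajectory on the time interval \<open>T\<close>. Since \<open>integral\<close> has a default value on
  non-integrable functions, integrability of the supplied power is demanded explicitly.\<close>

type_synonym ('s, 'm) behaviour = "real set \<Rightarrow> (real \<Rightarrow> 's) \<Rightarrow> (real \<Rightarrow> 'm) \<Rightarrow> (real \<Rightarrow> 'm) \<Rightarrow> bool"

definition cyclo_passive :: "('s, 'm::euclidean_space) behaviour \<Rightarrow> bool" where
  "cyclo_passive B \<longleftrightarrow>
     (\<forall>T x u y t1 t2. B T x u y \<and> t1 \<in> T \<and> t2 \<in> T \<and> t1 \<le> t2 \<and> x t1 = x t2 \<longrightarrow>
        (\<lambda>t. y t \<bullet> u t) absolutely_integrable_on {t1..t2} \<and>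
        0 \<le> integral {t1..t2} (\<lambda>t. y t \<bullet> u t))"

definition storage_function :: "('s, 'm::euclidean_space) behaviour \<Rightarrow> ('s \<Rightarrow> real) \<Rightarrow> bool" where
  "storage_function B S \<longleftrightarrow>
     (\<forall>T x u y t1 t2. B T x u y \<and> t1 \<in> T \<and> t2 \<in> T \<and> t1 \<le> t2 \<longrightarrow>
        (\<lambda>t. y t \<bullet> u t) absolutely_integrable_on {t1..t2} \<and>
        S (x t2) - S (x t1) \<le> integral {t1..t2} (\<lambda>t. y t \<bullet> u t))"

text \<open>The system constrained by \<open>y1 = ybar1\<close>, seen at the second port; the input \<open>u1\<close> is
  whatever is needed to maintain the constraint.\<close>

definition constrained_ph ::
    "((real^'n1) \<times> (real^'n2)) set \<Rightarrow> ((real^'n1) \<times> (real^'n2) \<Rightarrow> real) \<Rightarrow>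
     ((real^'n1) \<times> (real^'n2) \<Rightarrow> real^'n1^'n1) \<Rightarrow>
     ((real^'n1) \<times> (real^'n2) \<Rightarrow> real^'n2^'n2) \<Rightarrow>
     ((real^'n1) \<times> (real^'n2) \<Rightarrow> real^'n1 \<Rightarrow> real^'n1) \<Rightarrow>
     ((real^'n1) \<times> (real^'n2) \<Rightarrow> real^'n2 \<Rightarrow> real^'n2) \<Rightarrow>
     real^'n1^'n1 \<Rightarrow> ((real^'n1) \<times> (real^'n2) \<Rightarrow> real^'m2^'n2) \<Rightarrow>
     real^'n1 \<Rightarrow> ((real^'n1) \<times> (real^'n2), real^'m2) behaviour" where
  "constrained_ph X H J1 J2 R1 R2 G1 G2 ybar1 T x u2 y2 \<longleftrightarrow>
     (\<exists>u1 y1. ph_trajectory X H J1 J2 R1 R2 G1 G2 T x u1 y1 u2 y2 \<and> (\<forall>t\<in>T. y1 t = ybar1))"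

end

theory Submission
  imports Defs
begin

text \<open>Since \<open>G\<^sub>1\<close> is invertible, fixing \<open>y\<^sub>1\<close> fixes \<open>e\<^sub>1\<close>. By injectivity of the Legendre map,
  \<open>H\<^sub>1\<^sup>*(e\<^sub>1, x\<^sub>2)\<close> then coincides along the trajectory with \<open>V(x) = H(x) - e\<^sub>1 \<bullet> x\<^sub>1\<close>, so neither the
  inverse of the Legendre map nor its smoothness is needed: the chain rule leaves only
  \<open>e\<^sub>2 \<bullet> x\<^sub>2'\<close>, which is at most \<open>y\<^sub>2 \<bullet> u\<^sub>2\<close> by skew-symmetry and dissipativity. As \<open>V\<close> is locally
  Lipschitz, \<open>V \<circ> x\<close> is absolutely continuous and the almost everywhere inequality integrates.\<close>

section \<open>Absolute continuity: continuity and Lipschitz composition\<close>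

lemma abs_continuous_on_imp_continuous_on:
  assumes "abs_continuous_on {a..b} f"
  shows "continuous_on {a..b} f"
  unfolding continuous_on_iff
proof (intro ballI allI impI)
  fix t e :: real assume t: "t \<in> {a..b}" and "e > 0"
  with assms obtain d where "d > 0"
    and d: "\<And>\<D> s. \<D> division_of s \<Longrightarrow> s \<subseteq> {a..b} \<Longrightarrow> (\<Sum>k\<in>\<D>. Sup k - Inf k) < d \<Longrightarrow>
              (\<Sum>k\<in>\<D>. norm (f (Sup k) - f (Inf k))) < e"
    unfolding abs_continuous_on_def by meson
  have "dist (f s) (f t) < e" if "s \<in> {a..b}" "dist s t < d" for s
  proof -
    \<comment> \<open>A single interval, possibly degenerate, is already an admissible family; this
      case of the definition is uniform continuity.\<close>
    have "{{min s t..max s t}} division_of {min s t..max s t}"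
      using division_of_self[of "min s t" "max s t"] by (simp add: cbox_interval)
    from d[OF this] t that have "norm (f (max s t) - f (min s t)) < e"
      by (auto simp: dist_real_def)
    then show ?thesis
      by (cases "s \<le> t") (auto simp: dist_norm norm_minus_commute)
  qed
  then show "\<exists>d>0. \<forall>x'\<in>{a..b}. dist x' t < d \<longrightarrow> dist (f x') (f t) < e"
    using \<open>d > 0\<close> by blast
qed

lemma lipschitz_on_compose_abs_continuous_on:
  assumes f: "abs_continuous_on T f" and h: "L-lipschitz_on S h" and fS: "f ` T \<subseteq> S"
  shows "abs_continuous_on T (h \<circ> f)"
  unfolding abs_continuous_on_def
proof (intro allI impI)
  fix e :: real assume "e > 0"
  have "L \<ge> 0" using h by (rule lipschitz_on_nonneg)
  \<comment> \<open>Dividing by \<open>L + 1\<close> instead of \<open>L\<close> keeps the quotient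
    meaningful when \<open>L = 0\<close>.\<close>
  with \<open>e > 0\<close> have "e / (L + 1) > 0" by simp
  with f obtain d where "d > 0"
    and d: "\<And>\<D> s. \<D> division_of s \<Longrightarrow> s \<subseteq> T \<Longrightarrow> (\<Sum>k\<in>\<D>. Sup k - Inf k) < d \<Longrightarrow>
              (\<Sum>k\<in>\<D>. norm (f (Sup k) - f (Inf k))) < e / (L + 1)"
    unfolding abs_continuous_on_def by meson
  have "(\<Sum>k\<in>\<D>. norm ((h \<circ> f) (Sup k) - (h \<circ> f) (Inf k))) < e"
    if div: "\<D> division_of s" and s: "s \<subseteq> T" and "(\<Sum>k\<in>\<D>. Sup k - Inf k) < d" for \<D> s
  proof -
    have "norm ((h \<circ> f) (Sup k) - (h \<circ> f) (Inf k)) \<le> (L + 1) * norm (f (Sup k) - f (Inf k))"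
      if k: "k \<in> \<D>" for k
    proof -
      obtain u v where uv: "k = {u..v}" "u \<le> v"
        using division_ofD(3,4)[OF div k] by (auto simp: cbox_interval)
      then have "u \<in> T" "v \<in> T"
        using division_ofD(2)[OF div k] s by auto
      then have "norm (h (f v) - h (f u)) \<le> L * norm (f v - f u)"
        using lipschitz_on_normD[OF h] fS by blast
      also have "\<dots> \<le> (L + 1) * norm (f v - f u)"
        by (simp add: mult_right_mono)
      finally show ?thesis using uv by simp
    qed
    then have "(\<Sum>k\<in>\<D>. norm ((h \<circ> f) (Sup k) - (h \<circ> f) (Inf k)))
        \<le> (L + 1) * (\<Sum>k\<in>\<D>. norm (f (Sup k) - f (Inf k)))"
      by (simp only: sum_distrib_left sum_mono)
    also have "\<dots> < e"
      using d[OF that] \<open>L \<ge> 0\<close> by (simp add: field_simps)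
    finally show ?thesis .
  qed
  with \<open>d > 0\<close> show "\<exists>d>0. \<forall>\<D> s. \<D> division_of s \<and> s \<subseteq> T \<and> (\<Sum>k\<in>\<D>. Sup k - Inf k) < d \<longrightarrow>
      (\<Sum>k\<in>\<D>. norm ((h \<circ> f) (Sup k) - (h \<circ> f) (Inf k))) < e"
    by blast
qed

section \<open>Integrating an almost everywhere differential inequality\<close>

lemma negligible_outer_open:
  fixes N :: "'a::euclidean_space set"
  assumes "negligible N" "e > 0"
  obtains U where "open U" "N \<subseteq> U" "U \<in> lmeasurable" "measure lebesgue U < e"
proof -
  have N: "N \<in> null_sets lebesgue"
    using assms by (simp add: negligible_iff_null_sets)
  then have "N \<in> sets lebesgue" by blast
  then obtain U where U: "open U" "N \<subseteq> U" "U - N \<in> lmeasurable" "emeasure lebesgue (U - N) < ennreal e"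
    using sets_lebesgue_outer_open \<open>e > 0\<close> by metis
  have "U \<in> sets lebesgue"
    using \<open>open U\<close> by (simp add: borel_open)
  \<comment> \<open>Outer regularity only controls \<open>U - N\<close>; removing a null set leaves
    the measure of \<open>U\<close> unchanged, so the same bound holds for \<open>U\<close>.\<close>
  then have "emeasure lebesgue U < ennreal e"
    using U(4) emeasure_Diff_null_set[OF N] by simp
  moreover from this have "U \<in> lmeasurable"
    using \<open>U \<in> sets lebesgue\<close> by (intro fmeasurableI) (auto intro: less_trans ennreal_less_top)
  moreover from this have "measure lebesgue U < e"
    using \<open>emeasure lebesgue U < ennreal e\<close> \<open>e > 0\<close>
    by (metis emeasure_eq_measure2 ennreal_less_iff measure_nonneg)
  ultimately show thesis using that U by blast
qed

text \<open>Members of a division overlap only in negligible sets, so their lengths add up to the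
  measure of the union. This turns the small measure of an open set into the bound on total length
  that absolute continuity asks for.\<close>

lemma sum_measure_division_le:
  assumes "\<D> division_of S" "S \<subseteq> U" "U \<in> lmeasurable"
  shows "(\<Sum>k\<in>\<D>. measure lborel k) \<le> measure lebesgue U"
proof -
  have "(\<Sum>k\<in>\<D>. measure lborel k) = (\<Sum>k\<in>\<D>. measure lebesgue k)"
    using division_ofD(4)[OF assms(1)] by (intro sum.cong) (auto, fastforce)
  also have "\<dots> = measure lebesgue S"
    using content_division[OF assms(1)] by simp
  also have "\<dots> \<le> measure lebesgue U"
    using assms lmeasurable_division[OF assms(1)] by (intro measure_mono_fmeasurable) auto
  finally show ?thesis .
qed

text \<open>The increments over \<open>[u, t]\<close> and \<open>[t, v]\<close> are both compared
  with the same slope \<open>d\<close>, and the two errors add up to exactly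
  \<open>e * (v - u)\<close>. Intervals containing \<open>t\<close> are the ones that occur in a
  tagged division.\<close>

lemma derivative_within_straddle_le:
  fixes V :: "real \<Rightarrow> real"
  assumes "(V has_real_derivative d) (at t within S)" "d \<le> c" "e > 0"
  obtains r where "r > 0"
    "\<And>u v. u \<in> S \<Longrightarrow> v \<in> S \<Longrightarrow> u \<in> ball t r \<Longrightarrow> v \<in> ball t r \<Longrightarrow> u \<le> t \<Longrightarrow> t \<le> v \<Longrightarrow>
      V v - V u \<le> (c + e) * (v - u)"
proof -
  obtain r where "r > 0"
    and r: "\<And>y. y \<in> S \<Longrightarrow> norm (y - t) < r \<Longrightarrow> norm (V y - V t - d * (y - t)) \<le> e * norm (y - t)"
    using assms unfolding has_field_derivative_def has_derivative_within_alt by meson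
  show thesis
  proof (rule that[OF \<open>r > 0\<close>])
    fix u v assume uv: "u \<in> S" "v \<in> S" "u \<in> ball t r" "v \<in> ball t r" "u \<le> t" "t \<le> v"
    have "V v - V t - d * (v - t) \<le> e * (v - t)" "V t - V u - d * (t - u) \<le> e * (t - u)"
      using r[of u] r[of v] uv by (auto simp: dist_real_def abs_le_iff algebra_simps)
    then have "V v - V u \<le> (d + e) * (v - u)"
      by (simp add: algebra_simps)
    also have "\<dots> \<le> (c + e) * (v - u)"
      using assms uv by (intro mult_right_mono) auto
    finally show "V v - V u \<le> (c + e) * (v - u)" .
  qed
qed

text \<open>The gauge confines intervals tagged in the exceptional set \<open>N\<close> to an open set of small
  measure, where absolute continuity bounds the variation of \<open>V\<close>; at all other tags the
  derivative controls the increment.\<close>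

lemma abs_continuous_on_increment_le_integral:
  fixes V g :: "real \<Rightarrow> real"
  assumes "a \<le> b"
    and ac: "abs_continuous_on {a..b} V"
    and g: "g integrable_on {a..b}"
    and N: "negligible N"
    and deriv: "\<And>t. t \<in> {a..b} - N \<Longrightarrow>
      \<exists>d. (V has_real_derivative d) (at t within {a..b}) \<and> d \<le> g t"
  shows "V b - V a \<le> integral {a..b} g"
proof (rule field_le_epsilon)
  fix \<epsilon> :: real assume "\<epsilon> > 0"
  \<comment> \<open>Error budget: \<open>e\<close> for the Riemann sum, \<open>e * (b - a)\<close>
    for the derivative estimates, and \<open>e\<close> for the intervals tagged in
    \<open>N\<close>.\<close>
  define e where "e = \<epsilon> / (b - a + 2)"
  have "e > 0" using \<open>\<epsilon> > 0\<close> \<open>a \<le> b\<close> by (simp add: e_def)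
  \<comment> \<open>Changing \<open>g\<close> on the negligible set preserves the integral and makes
    the Riemann terms with tags in \<open>N\<close> vanish.\<close>
  define g0 where "g0 t = (if t \<in> N then 0 else g t)" for t
  have "(g0 has_integral integral {a..b} g) {a..b}"
    by (rule has_integral_spike[OF N _ integrable_integral[OF g]]) (simp add: g0_def)
  with \<open>e > 0\<close> obtain \<gamma> where "gauge \<gamma>"
    and \<gamma>: "\<And>p. p tagged_division_of {a..b} \<Longrightarrow> \<gamma> fine p \<Longrightarrow>
      norm ((\<Sum>(t, k)\<in>p. measure lborel k *\<^sub>R g0 t) - integral {a..b} g) < e"
    unfolding has_integral_real by meson
  obtain \<delta> where "\<delta> > 0"
    and \<delta>: "\<And>\<D> s. \<D> division_of s \<Longrightarrow> s \<subseteq> {a..b} \<Longrightarrow> (\<Sum>k\<in>\<D>. Sup k - Inf k) < \<delta> \<Longrightarrow>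
      (\<Sum>k\<in>\<D>. norm (V (Sup k) - V (Inf k))) < e"
    using ac \<open>e > 0\<close> unfolding abs_continuous_on_def by meson
  obtain U where U: "open U" "N \<subseteq> U" "U \<in> lmeasurable" "measure lebesgue U < \<delta>"
    using negligible_outer_open[OF N \<open>\<delta> > 0\<close>] .
  have "\<forall>t\<in>{a..b} - N. \<exists>r>0. \<forall>u\<in>{a..b}. \<forall>v\<in>{a..b}. u \<in> ball t r \<and> v \<in> ball t r \<and> u \<le> t \<and> t \<le> v \<longrightarrow>
      V v - V u \<le> (g t + e) * (v - u)"
  proof
    fix t assume "t \<in> {a..b} - N"
    then obtain d where "(V has_real_derivative d) (at t within {a..b})" "d \<le> g t"
      using deriv by blast
    then obtain r where "r > 0" "\<And>u v. u \<in> {a..b} \<Longrightarrow> v \<in> {a..b} \<Longrightarrow> u \<in> ball t r \<Longrightarrow>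
        v \<in> ball t r \<Longrightarrow> u \<le> t \<Longrightarrow> t \<le> v \<Longrightarrow> V v - V u \<le> (g t + e) * (v - u)"
      using derivative_within_straddle_le[OF _ _ \<open>e > 0\<close>] by metis
    then show "\<exists>r>0. \<forall>u\<in>{a..b}. \<forall>v\<in>{a..b}. u \<in> ball t r \<and> v \<in> ball t r \<and> u \<le> t \<and> t \<le> v \<longrightarrow>
        V v - V u \<le> (g t + e) * (v - u)"
      by (intro exI[of _ r]) simp
  qed
  then obtain r where r: "\<And>t. t \<in> {a..b} - N \<Longrightarrow> r t > 0"
    "\<And>t u v. t \<in> {a..b} - N \<Longrightarrow> u \<in> {a..b} \<Longrightarrow> v \<in> {a..b} \<Longrightarrow> u \<in> ball t (r t) \<Longrightarrow>
      v \<in> ball t (r t) \<Longrightarrow> u \<le> t \<Longrightarrow> t \<le> v \<Longrightarrow> V v - V u \<le> (g t + e) * (v - u)"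
    unfolding bchoice_iff by blast
  \<comment> \<open>On \<open>N\<close> the gauge condition holds because \<open>U\<close> is open
    and contains \<open>N\<close>. Tags outside \<open>{a..b}\<close> never occur, so
    \<open>UNIV\<close> is a mere filler.\<close>
  define \<eta> where "\<eta> t = (if t \<in> N then U else if t \<in> {a..b} then ball t (r t) else UNIV)" for t
  have "gauge \<eta>"
    using U r(1) by (auto simp: gauge_def \<eta>_def)
  with \<open>gauge \<gamma>\<close> have "gauge (\<lambda>t. \<gamma> t \<inter> \<eta> t)"
    by (rule gauge_Int)
  then obtain p where p: "p tagged_division_of {a..b}" and "(\<lambda>t. \<gamma> t \<inter> \<eta> t) fine p"
    using fine_division_exists_real by blast
  then have "\<gamma> fine p" and \<eta>: "\<eta> fine p"
    by (auto simp: fine_Int)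
  have pD: "\<exists>u v. K = {u..v} \<and> u \<le> t \<and> t \<le> v \<and> u \<in> {a..b} \<and> v \<in> {a..b} \<and> K \<subseteq> \<eta> t"
    if "(t, K) \<in> p" for t K
    using tagged_division_ofD(2,3,4)[OF p that] \<eta> that by (fastforce simp: fine_def)
  define q where "q = {(t, K) \<in> p. t \<in> N}"
  have "q \<subseteq> p" "finite p"
    using p by (auto simp: q_def)
  have q: "q tagged_partial_division_of {a..b}"
    using p \<open>q \<subseteq> p\<close> tagged_partial_division_subset tagged_division_of_def by blast
  note D = partial_division_of_tagged_division[OF q]
  have D_ab: "\<Union>(snd ` q) \<subseteq> {a..b}"
    using tagged_partial_division_ofD(3)[OF q] by (metis Union_least imageE prod.collapse)
  have D_U: "\<Union>(snd ` q) \<subseteq> U"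
    using \<eta> by (fastforce simp: q_def fine_def \<eta>_def)
  have "(\<Sum>K\<in>snd ` q. Sup K - Inf K) = (\<Sum>K\<in>snd ` q. measure lborel K)"
    using pD \<open>q \<subseteq> p\<close> by (intro sum.cong) fastforce+
  also have "\<dots> \<le> measure lebesgue U"
    by (rule sum_measure_division_le[OF D D_U U(3)])
  finally have small: "(\<Sum>K\<in>snd ` q. norm (V (Sup K) - V (Inf K))) < e"
    using \<delta>[OF D D_ab] U(4) by linarith
  \<comment> \<open>Passing from a sum over tagged intervals to one over the set of intervals
    requires a summand that vanishes on degenerate intervals, since several tags may share one.
    Singletons satisfy this automatically; the empty set needs its own case because
    \<open>Sup {}\<close> and \<open>Inf {}\<close> carry no useful value.\<close>
  define \<nu> where "\<nu> K = (if K = {} then 0 else norm (V (Sup K) - V (Inf K)))" for K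
  have \<nu>: "\<nu> K = norm (V (Sup K) - V (Inf K))" if "(t, K) \<in> p" for t K
    using pD[OF that] by (auto simp: \<nu>_def)
  have "(\<Sum>(t, K)\<in>q. \<nu> K) = (\<Sum>K\<in>snd ` q. \<nu> K)"
    by (rule sum.over_tagged_division_lemma[OF tagged_partial_division_of_Union_self[OF q]])
      (auto simp: \<nu>_def)
  also have "\<dots> = (\<Sum>K\<in>snd ` q. norm (V (Sup K) - V (Inf K)))"
    using \<nu> \<open>q \<subseteq> p\<close> by (intro sum.cong) auto
  also note small
  finally have q_sum: "(\<Sum>(t, K)\<in>q. \<nu> K) < e" .
  have step: "V (Sup K) - V (Inf K) \<le>
      measure lborel K *\<^sub>R g0 t + e * measure lborel K + (if t \<in> N then \<nu> K else 0)" if tK: "(t, K) \<in> p" for t K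
  proof -
    obtain u v where K: "K = {u..v}" "u \<le> t" "t \<le> v" "u \<in> {a..b}" "v \<in> {a..b}" "K \<subseteq> \<eta> t"
      using pD[OF tK] by blast
    show ?thesis
    proof (cases "t \<in> N")
      case True
      then show ?thesis using K \<nu>[OF tK] \<open>e > 0\<close> by (simp add: g0_def add_increasing)
    next
      case False
      have t: "t \<in> {a..b} - N" using K False by auto
      have "K \<subseteq> ball t (r t)"
        using K(6) t by (simp add: \<eta>_def)
      moreover have "u \<in> K" "v \<in> K" using K by auto
      ultimately have "V v - V u \<le> (g t + e) * (v - u)"
        using K t by (intro r(2)) blast+
      then show ?thesis using K False by (simp add: g0_def algebra_simps)
    qed
  qed
  have "V b - V a = (\<Sum>(t, K)\<in>p. V (Sup K) - V (Inf K))"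
    by (rule additive_tagged_division_1[OF \<open>a \<le> b\<close> p, symmetric])
  also have "\<dots> \<le> (\<Sum>(t, K)\<in>p. measure lborel K *\<^sub>R g0 t + e * measure lborel K + (if t \<in> N then \<nu> K else 0))"
    using step by (intro sum_mono) auto
  also have "\<dots> = (\<Sum>(t, K)\<in>p. measure lborel K *\<^sub>R g0 t) + e * (\<Sum>(t, K)\<in>p. measure lborel K)
      + (\<Sum>(t, K)\<in>p. if t \<in> N then \<nu> K else 0)"
    by (simp add: sum.distrib sum_distrib_left case_prod_unfold)
  also have "(\<Sum>(t, K)\<in>p. if t \<in> N then \<nu> K else 0) = (\<Sum>(t, K)\<in>q. \<nu> K)"
    unfolding q_def using \<open>finite p\<close>
    by (simp add: case_prod_unfold sum.If_cases Int_def)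
  also have "(\<Sum>(t, K)\<in>p. measure lborel K) = b - a"
    using additive_content_tagged_division[of p a b] p \<open>a \<le> b\<close> by simp
  finally have "V b - V a \<le> integral {a..b} g + e + e * (b - a) + e"
    using \<gamma>[OF p \<open>\<gamma> fine p\<close>] q_sum by (simp add: abs_less_iff)
  also have "\<dots> = integral {a..b} g + e * (b - a + 2)"
    by (simp add: algebra_simps)
  also have "\<dots> = integral {a..b} g + \<epsilon>"
    using \<open>a \<le> b\<close> by (simp add: e_def)
  finally show "V b - V a \<le> integral {a..b} g + \<epsilon>" .
qed

section \<open>Partial gradients and Lipschitz bounds for C1 functions\<close>

lemma gderiv_unique:
  assumes "GDERIV f x :> g" "GDERIV f x :> g'"
  shows "g = g'"
proof -
  have "(\<lambda>h. inner h g) = (\<lambda>h. inner h g')"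
    using assms unfolding gderiv_def by (rule has_derivative_unique)
  then show ?thesis
    by (metis vector_eq_ldot)
qed

text \<open>\<open>adjoint D 1\<close> is the Riesz representative of the linear functional
  \<open>D\<close>.\<close>

lemma gderiv_adjoint:
  fixes f :: "'a::euclidean_space \<Rightarrow> real"
  assumes "(f has_derivative D) (at x)"
  shows "GDERIV f x :> adjoint D 1"
proof -
  have "linear D"
    using assms has_derivative_linear by blast
  then have "h \<bullet> adjoint D 1 = D h" for h
    using adjoint_works[of D h 1] by simp
  then show ?thesis
    using assms by (simp add: gderiv_def)
qed

text \<open>Restricting \<open>H\<close> to a slice is composition with an affine embedding, so the
  chain rule yields a slice derivative and hence a gradient. Its uniqueness pins down the definite
  descriptions in \<open>grad1\<close> and \<open>grad2\<close>.\<close>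

lemma
  fixes H :: "'a::euclidean_space \<times> 'b::euclidean_space \<Rightarrow> real"
  assumes D: "(H has_derivative D) (at x)"
  shows inner_grad1: "h \<bullet> grad1 H x = D (h, 0)"
    and inner_grad2: "k \<bullet> grad2 H x = D (0, k)"
proof -
  have D': "(H has_derivative D) (at (fst x, snd x))"
    using D by simp
  have "((\<lambda>z. H (z, snd x)) has_derivative (\<lambda>h. D (h, 0))) (at (fst x))"
    by (rule has_derivative_compose[where f = "\<lambda>z. (z, snd x)", OF _ D'])
      (auto intro!: derivative_eq_intros)
  note 1 = gderiv_adjoint[OF this]
  have "grad1 H x = adjoint (\<lambda>h. D (h, 0)) 1"
    unfolding grad1_def using gderiv_unique[OF _ 1] by (intro the_equality 1)
  moreover have "linear (\<lambda>h. D (h, 0))"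
    using \<open>((\<lambda>z. H (z, snd x)) has_derivative _) _\<close> has_derivative_linear by blast
  ultimately show "h \<bullet> grad1 H x = D (h, 0)"
    using adjoint_works[of "\<lambda>h. D (h, 0)" h 1] by simp
  have "((\<lambda>z. H (fst x, z)) has_derivative (\<lambda>k. D (0, k))) (at (snd x))"
    by (rule has_derivative_compose[where f = "\<lambda>z. (fst x, z)", OF _ D'])
      (auto intro!: derivative_eq_intros)
  note 2 = gderiv_adjoint[OF this]
  have "grad2 H x = adjoint (\<lambda>k. D (0, k)) 1"
    unfolding grad2_def using gderiv_unique[OF _ 2] by (intro the_equality 2)
  moreover have "linear (\<lambda>k. D (0, k))"
    using \<open>((\<lambda>z. H (fst x, z)) has_derivative _) _\<close> has_derivative_linear by blast
  ultimately show "k \<bullet> grad2 H x = D (0, k)"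
    using adjoint_works[of "\<lambda>k. D (0, k)" k 1] by simp
qed

lemma has_derivative_grads:
  fixes H :: "'a::euclidean_space \<times> 'b::euclidean_space \<Rightarrow> real"
  assumes D: "(H has_derivative D) (at x)"
  shows "(H has_derivative (\<lambda>h. fst h \<bullet> grad1 H x + snd h \<bullet> grad2 H x)) (at x)"
proof -
  have "linear D"
    using D has_derivative_linear by blast
  have "D h = fst h \<bullet> grad1 H x + snd h \<bullet> grad2 H x" for h
    using linear_add[OF \<open>linear D\<close>, of "(fst h, 0)" "(0, snd h)"] inner_grad1[OF D] inner_grad2[OF D]
    by simp
  then have "D = (\<lambda>h. fst h \<bullet> grad1 H x + snd h \<bullet> grad2 H x)" ..
  with D show ?thesis by simp
qed

text \<open>Each coordinate of the gradient is \<open>D x\<close> evaluated at a fixed vector. This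
  is what makes the output \<open>y2\<close> continuous along a trajectory.\<close>

lemma continuous_on_grad2:
  fixes H :: "'a::euclidean_space \<times> 'b::euclidean_space \<Rightarrow> real"
  assumes "\<And>x. x \<in> X \<Longrightarrow> (H has_derivative blinfun_apply (D x)) (at x)" "continuous_on X D"
  shows "continuous_on X (grad2 H)"
  unfolding continuous_on_componentwise[of X "grad2 H"]
proof
  fix i :: 'b assume "i \<in> Basis"
  have "continuous_on X (\<lambda>x. blinfun_apply (D x) (0, i))"
    by (intro continuous_intros assms)
  then show "continuous_on X (\<lambda>x. grad2 H x \<bullet> i)"
    by (rule continuous_on_eq) (simp add: inner_grad2[OF assms(1), symmetric] inner_commute)
qed

text \<open>\<open>K\<close> need not be convex; it will be the image of a trajectory segment. So
  the mean value inequality is applied on small balls inside \<open>X\<close>, where continuity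
  bounds the derivative, and compactness of \<open>K\<close> turns the local Lipschitz constants
  into a global one.\<close>

lemma C1_imp_lipschitz_on_compact:
  fixes f :: "'a::real_normed_vector \<Rightarrow> 'b::real_normed_vector"
  assumes "open X" "compact K" "K \<subseteq> X"
    and D: "\<And>x. x \<in> X \<Longrightarrow> (f has_derivative blinfun_apply (D x)) (at x)"
    and cont: "continuous_on X D"
  obtains L where "L-lipschitz_on K f"
proof -
  \<comment> \<open>\<open>local_lipschitz\<close> concerns time-dependent families; the one-point
    time set \<open>{0}\<close> specialises it to a single function.\<close>
  have "local_lipschitz {0::real} K (\<lambda>_. f)"
  proof (rule local_lipschitzI)
    fix t :: real and x assume "x \<in> K"
    then have "x \<in> X" using \<open>K \<subseteq> X\<close> by blast
    then have "continuous (at x) D"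
      using cont \<open>open X\<close> by (simp add: continuous_on_eq_continuous_at)
    then obtain d where "d > 0" and d: "\<And>y. dist y x < d \<Longrightarrow> dist (D y) (D x) < 1"
      unfolding continuous_at_eps_delta using zero_less_one by blast
    obtain r where "r > 0" and r: "cball x r \<subseteq> X"
      using \<open>open X\<close> \<open>x \<in> X\<close> open_contains_cball by blast
    \<comment> \<open>Half of \<open>d\<close> puts the closed ball inside the open ball on which
      \<open>D\<close> varies by less than 1.\<close>
    define u where "u = min r (d / 2)"
    have "u > 0" using \<open>r > 0\<close> \<open>d > 0\<close> by (simp add: u_def)
    have "(norm (D x) + 1)-lipschitz_on (cball x u) f"
    proof (rule bounded_derivative_imp_lipschitz)
      fix y assume y: "y \<in> cball x u"
      then have "y \<in> X" using r by (auto simp: u_def)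
      then show "(f has_derivative blinfun_apply (D y)) (at y within cball x u)"
        using D has_derivative_at_withinI by blast
      have "dist y x < d" using y \<open>d > 0\<close> by (auto simp: u_def dist_commute)
      then have "norm (D y) \<le> norm (D x) + 1"
        using d[of y] norm_triangle_sub[of "D y" "D x"] by (simp add: dist_norm)
      then show "onorm (blinfun_apply (D y)) \<le> norm (D x) + 1"
        by (simp add: norm_blinfun.rep_eq)
    qed auto
    then have "(norm (D x) + 1)-lipschitz_on (cball x u \<inter> K) f"
      by (rule lipschitz_on_subset) auto
    then show "\<exists>u>0. \<exists>L. \<forall>t\<in>cball t u \<inter> {0}. L-lipschitz_on (cball x u \<inter> K) f"
      using \<open>u > 0\<close> by blast
  qed
  then show thesis
    using local_lipschitz_compact_implies_lipschitz[where X = K and T = "{0::real}" and f = "\<lambda>_. f"] \<open>compact K\<close> that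
    by auto
qed

section \<open>Power balance, the partial Legendre transform and the supplied power\<close>

lemma inner_skew_eq_0:
  fixes A :: "real^'n^'n"
  assumes "transpose A = - A"
  shows "x \<bullet> (A *v x) = 0"
proof -
  have "x \<bullet> (A *v x) = (transpose A *v x) \<bullet> x"
    by (simp add: dot_lmul_matrix)
  also have "\<dots> = - (x \<bullet> (A *v x))"
    using matrix_vector_mult_diff_rdistrib[of 0 A x] by (simp add: assms inner_commute)
  finally show ?thesis by simp
qed

text \<open>The skew-symmetric term does no work and \<open>r\<close> can only dissipate, which
  leaves the power entering through \<open>G\<close>; transposing \<open>G\<close> expresses it by
  the output.\<close>

lemma port_power_balance:
  fixes J :: "real^'n^'n" and G :: "real^'m^'n"
  assumes "transpose J = - J" "0 \<le> e \<bullet> r"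
  shows "(J *v e - r + G *v u) \<bullet> e \<le> (transpose G *v e) \<bullet> u"
proof -
  have "(J *v e - r + G *v u) \<bullet> e = e \<bullet> (J *v e) - e \<bullet> r + e \<bullet> (G *v u)"
    by (subst inner_commute) (simp add: inner_add_right inner_diff_right)
  also have "\<dots> \<le> e \<bullet> (G *v u)"
    using inner_skew_eq_0[OF assms(1)] assms(2) by simp
  finally show ?thesis
    by (simp add: dot_lmul_matrix)
qed

text \<open>By injectivity, \<open>fst x\<close> is the only candidate for the definite description
  inside \<open>partial_legendre\<close>.\<close>

lemma partial_legendre_eq:
  assumes "inj_on (\<lambda>x. (grad1 H x, snd x)) X" "x \<in> X"
  shows "partial_legendre X H (grad1 H x) (snd x) = H x - grad1 H x \<bullet> fst x"
proof -
  have "(THE x1. (x1, snd x) \<in> X \<and> grad1 H (x1, snd x) = grad1 H x) = fst x"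
  proof (rule the_equality)
    fix x1 assume "(x1, snd x) \<in> X \<and> grad1 H (x1, snd x) = grad1 H x"
    then have "(x1, snd x) = x"
      using inj_onD[OF assms(1), of "(x1, snd x)" x] assms(2) by simp
    then show "x1 = fst x" by (metis fst_conv)
  qed (use assms in simp)
  then show ?thesis by (simp add: partial_legendre_def)
qed

text \<open>Subtracting \<open>e\<^sub>1 \<bullet> x\<^sub>1\<close> with \<open>e\<^sub>1\<close> frozen at its current value cancels the contribution of
  \<open>x\<^sub>1\<close> to the rate of change of the Hamiltonian.\<close>

lemma has_real_derivative_hamiltonian_minus:
  fixes H :: "'a::euclidean_space \<times> 'b::euclidean_space \<Rightarrow> real"
  assumes H: "(H has_derivative D) (at (x t))"
    and x1: "((\<lambda>s. fst (x s)) has_vector_derivative v1) (at t within T)"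
    and x2: "((\<lambda>s. snd (x s)) has_vector_derivative v2) (at t within T)"
  shows "((\<lambda>s. H (x s) - grad1 H (x t) \<bullet> fst (x s)) has_real_derivative v2 \<bullet> grad2 H (x t))
    (at t within T)"
proof -
  have "(x has_derivative (\<lambda>h. (h *\<^sub>R v1, h *\<^sub>R v2))) (at t within T)"
    using has_derivative_Pair[OF x1[unfolded has_vector_derivative_def] x2[unfolded has_vector_derivative_def]]
    by simp
  from has_derivative_compose[OF this has_derivative_grads[OF H]]
  have "((\<lambda>s. H (x s)) has_derivative (\<lambda>h. h * (v1 \<bullet> grad1 H (x t) + v2 \<bullet> grad2 H (x t)))) (at t within T)"
    by (simp add: algebra_simps)
  moreover have "((\<lambda>s. grad1 H (x t) \<bullet> fst (x s)) has_derivative (\<lambda>h. grad1 H (x t) \<bullet> (h *\<^sub>R v1)))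
      (at t within T)"
    by (intro has_derivative_inner_right x1[unfolded has_vector_derivative_def])
  ultimately have "((\<lambda>s. H (x s) - grad1 H (x t) \<bullet> fst (x s)) has_derivative
      (\<lambda>h. h * (v1 \<bullet> grad1 H (x t) + v2 \<bullet> grad2 H (x t)) - grad1 H (x t) \<bullet> (h *\<^sub>R v1))) (at t within T)"
    by (rule has_derivative_diff)
  then show ?thesis
    unfolding has_field_derivative_def
    by (rule has_derivative_eq_rhs) (auto simp: algebra_simps inner_commute)
qed

text \<open>A continuous factor on a compact interval is bounded and measurable. Applied to
  \<open>y2\<close> and \<open>u2\<close>, this makes the supplied power integrable.\<close>

lemma absolutely_integrable_inner_continuous:
  fixes f g :: "real \<Rightarrow> 'a::euclidean_space"
  assumes "continuous_on {a..b} f" "g absolutely_integrable_on {a..b}"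
  shows "(\<lambda>t. f t \<bullet> g t) absolutely_integrable_on {a..b}"
proof (rule absolutely_integrable_bounded_measurable_product[where h = "(\<bullet>)"])
  show "bilinear ((\<bullet>) :: 'a \<Rightarrow> 'a \<Rightarrow> real)"
    by (rule bilinear_conv_bounded_bilinear[THEN iffD2, OF bounded_bilinear_inner])
  show "f \<in> borel_measurable (lebesgue_on {a..b})"
    using assms by (intro continuous_imp_measurable_on_sets_lebesgue) auto
  show "bounded (f ` {a..b})"
    using assms by (intro compact_imp_bounded compact_continuous_image) auto
qed (use assms in auto)

section \<open>The constrained system: constancy of the co-energy variable, dissipation inequality,
  cyclo-passivity\<close>

theorem theorem2:
  fixes X :: "((real^'n1) \<times> (real^'n2)) set"
    and H :: "(real^'n1) \<times> (real^'n2) \<Rightarrow> real"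
    and J1 :: "(real^'n1) \<times> (real^'n2) \<Rightarrow> real^'n1^'n1"
    and J2 :: "(real^'n1) \<times> (real^'n2) \<Rightarrow> real^'n2^'n2"
    and R1 :: "(real^'n1) \<times> (real^'n2) \<Rightarrow> real^'n1 \<Rightarrow> real^'n1"
    and R2 :: "(real^'n1) \<times> (real^'n2) \<Rightarrow> real^'n2 \<Rightarrow> real^'n2"
    and G1 :: "real^'n1^'n1"
    and G2 :: "(real^'n1) \<times> (real^'n2) \<Rightarrow> real^'m2^'n2"
  assumes "open X"
    and "C2_on X H"
    and "continuous_on X J1" and "continuous_on X J2"
    and "continuous_on (X \<times> UNIV) (\<lambda>(x, e). R1 x e)"
    and "continuous_on (X \<times> UNIV) (\<lambda>(x, e). R2 x e)"
    and "continuous_on X G2"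
    and "\<forall>x\<in>X. transpose (J1 x) = - J1 x"
    and "\<forall>x\<in>X. transpose (J2 x) = - J2 x"
    and "\<forall>x\<in>X. \<forall>e1. 0 \<le> e1 \<bullet> R1 x e1"
    and "\<forall>x\<in>X. \<forall>e2. 0 \<le> e2 \<bullet> R2 x e2"
    and "invertible G1"
    and "partial_legendre_wf X H"
  shows "\<forall>ybar1. \<exists>ebar1.
    (\<forall>T x u1 y1 u2 y2.
       ph_trajectory X H J1 J2 R1 R2 G1 G2 T x u1 y1 u2 y2 \<and> (\<forall>t\<in>T. y1 t = ybar1) \<longrightarrow>
         (\<forall>t\<in>T. grad1 H (x t) = ebar1) \<and>
         (AE t in lebesgue. t \<in> T \<longrightarrow>
            (\<exists>d. ((\<lambda>s. partial_legendre X H ebar1 (snd (x s))) has_real_derivative d) (at t within T) \<and>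
                 d \<le> y2 t \<bullet> u2 t))) \<and>
    cyclo_passive (constrained_ph X H J1 J2 R1 R2 G1 G2 ybar1) \<and>
    storage_function (constrained_ph X H J1 J2 R1 R2 G1 G2 ybar1)
      (\<lambda>x. partial_legendre X H ebar1 (snd x))"
proof
  fix ybar1 :: "real^'n1"
  note J2_skew = assms(9) and R2_pos = assms(11)
  have inj: "inj_on (\<lambda>x. (grad1 H x, snd x)) X"
    using assms(13) by (simp add: partial_legendre_wf_def)
  \<comment> \<open>The second derivative supplied by \<open>C2_on\<close> makes \<open>D\<close>
    differentiable, hence continuous, on \<open>X\<close>.\<close>
  obtain D where H: "\<And>x. x \<in> X \<Longrightarrow> (H has_derivative blinfun_apply (D x)) (at x)"
    and D: "continuous_on X D"
    using assms(2) unfolding C2_on_def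
    by (metis continuous_at_imp_continuous_on has_derivative_continuous)
  obtain B where B: "B ** transpose G1 = mat 1"
    using assms(12) unfolding invertible_def by (metis matrix_transpose_mul transpose_mat)
  \<comment> \<open>\<open>B\<close> inverts \<open>transpose G1\<close>, so \<open>ebar\<close>
    depends on \<open>ybar1\<close> alone and one vector serves all constrained
    trajectories.\<close>
  define ebar where "ebar = B *v ybar1"
  define V where "V z = H z - ebar \<bullet> fst z" for z
  have e_const: "grad1 H (x t) = ebar"
    if "ph_trajectory X H J1 J2 R1 R2 G1 G2 T x u1 y1 u2 y2" "\<forall>t\<in>T. y1 t = ybar1" "t \<in> T"
    for T x u1 y1 u2 y2 t
  proof -
    have "ebar = B *v (transpose G1 *v grad1 H (x t))"
      using that by (simp add: ph_trajectory_def ebar_def)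
    then show ?thesis
      by (simp add: matrix_vector_mul_assoc B del: transpose_matrix_vector)
  qed
  have legendre: "partial_legendre X H ebar (snd (x t)) = V (x t)"
    if "ph_trajectory X H J1 J2 R1 R2 G1 G2 T x u1 y1 u2 y2" "\<forall>t\<in>T. y1 t = ybar1" "t \<in> T"
    for T x u1 y1 u2 y2 t
    using partial_legendre_eq[OF inj, of "x t"] e_const[OF that] that
    by (auto simp: ph_trajectory_def V_def)
  have deriv: "AE t in lebesgue. t \<in> T \<longrightarrow>
      (\<exists>d. ((\<lambda>s. V (x s)) has_real_derivative d) (at t within T) \<and> d \<le> y2 t \<bullet> u2 t)"
    if traj: "ph_trajectory X H J1 J2 R1 R2 G1 G2 T x u1 y1 u2 y2" "\<forall>t\<in>T. y1 t = ybar1"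
    for T x u1 y1 u2 y2
  proof -
    let ?v1 = "\<lambda>t. J1 (x t) *v grad1 H (x t) - R1 (x t) (grad1 H (x t)) + G1 *v u1 t"
    let ?v2 = "\<lambda>t. J2 (x t) *v grad2 H (x t) - R2 (x t) (grad2 H (x t)) + G2 (x t) *v u2 t"
    have "AE t in lebesgue. t \<in> T \<longrightarrow> ((\<lambda>s. fst (x s)) has_vector_derivative ?v1 t) (at t within T)"
      and "AE t in lebesgue. t \<in> T \<longrightarrow> ((\<lambda>s. snd (x s)) has_vector_derivative ?v2 t) (at t within T)"
      using traj by (auto simp: ph_trajectory_def)
    then show ?thesis
    proof eventually_elim
      case (elim t)
      show ?case
      proof
        assume t: "t \<in> T"
        then have xt: "x t \<in> X" and y2: "y2 t = transpose (G2 (x t)) *v grad2 H (x t)"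
          using traj by (auto simp: ph_trajectory_def)
        have "((\<lambda>s. V (x s)) has_real_derivative ?v2 t \<bullet> grad2 H (x t)) (at t within T)"
          using has_real_derivative_hamiltonian_minus[where x = x, OF H[OF xt]] elim t e_const[OF traj t]
          by (simp add: V_def)
        moreover have "?v2 t \<bullet> grad2 H (x t) \<le> y2 t \<bullet> u2 t"
          unfolding y2 using J2_skew R2_pos xt by (intro port_power_balance) auto
        ultimately show "\<exists>d. ((\<lambda>s. V (x s)) has_real_derivative d) (at t within T) \<and> d \<le> y2 t \<bullet> u2 t"
          by blast
      qed
    qed
  qed
  have storage: "(\<lambda>t. y2 t \<bullet> u2 t) absolutely_integrable_on {t1..t2} \<and>
      V (x t2) - V (x t1) \<le> integral {t1..t2} (\<lambda>t. y2 t \<bullet> u2 t)"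
    if traj: "ph_trajectory X H J1 J2 R1 R2 G1 G2 T x u1 y1 u2 y2" "\<forall>t\<in>T. y1 t = ybar1"
      and t12: "t1 \<in> T" "t2 \<in> T" "t1 \<le> t2"
    for T x u1 y1 u2 y2 t1 t2
  proof
    have T: "{t1..t2} \<subseteq> T"
      using traj t12 unfolding ph_trajectory_def by (meson atLeastAtMost_iff is_interval_1 subsetI)
    then have xX: "x ` {t1..t2} \<subseteq> X" and ac: "abs_continuous_on {t1..t2} x"
      and u2: "u2 absolutely_integrable_on {t1..t2}"
      and y2: "\<And>t. t \<in> {t1..t2} \<Longrightarrow> y2 t = transpose (G2 (x t)) *v grad2 H (x t)"
      using traj unfolding ph_trajectory_def loc_abs_continuous_on_def loc_integrable_on_def by blast+
    have x: "continuous_on {t1..t2} x"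
      using ac by (rule abs_continuous_on_imp_continuous_on)
    have "continuous_on {t1..t2} (\<lambda>t. G2 (x t))" "continuous_on {t1..t2} (\<lambda>t. grad2 H (x t))"
      using x xX continuous_on_compose2[OF assms(7)] continuous_on_compose2[OF continuous_on_grad2[OF H D]]
      by blast+
    then have "continuous_on {t1..t2} (\<lambda>t. transpose (G2 (x t)) *v grad2 H (x t))"
      unfolding transpose_def matrix_vector_mult_def by (auto intro!: continuous_intros)
    then have "continuous_on {t1..t2} y2"
      by (rule continuous_on_eq) (simp add: y2)
    then show int: "(\<lambda>t. y2 t \<bullet> u2 t) absolutely_integrable_on {t1..t2}"
      using u2 by (rule absolutely_integrable_inner_continuous)
    \<comment> \<open>\<open>V\<close> is a C1 function minus a linear one; Lipschitz constants for
      the two on the compact image of the segment add up to one for \<open>V\<close>.\<close>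
    obtain L where "L-lipschitz_on (x ` {t1..t2}) H"
      using C1_imp_lipschitz_on_compact[OF assms(1) _ xX H D] compact_continuous_image[OF x]
      by blast
    moreover have "(norm ebar)-lipschitz_on (x ` {t1..t2}) (\<lambda>z. ebar \<bullet> fst z)"
    proof (rule lipschitz_onI)
      fix z w :: "(real^'n1) \<times> (real^'n2)"
      have "\<bar>ebar \<bullet> (fst z - fst w)\<bar> \<le> norm ebar * norm (fst z - fst w)"
        by (rule Cauchy_Schwarz_ineq2)
      also have "\<dots> \<le> norm ebar * dist z w"
        using dist_fst_le[of z w] by (simp add: dist_norm mult_left_mono)
      finally show "dist (ebar \<bullet> fst z) (ebar \<bullet> fst w) \<le> norm ebar * dist z w"
        by (simp add: dist_real_def inner_diff_right)
    qed simp
    ultimately have "(L + norm ebar)-lipschitz_on (x ` {t1..t2}) V"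
      unfolding V_def by (rule lipschitz_on_diff)
    then have acV: "abs_continuous_on {t1..t2} (V \<circ> x)"
      using lipschitz_on_compose_abs_continuous_on[OF ac] by blast
    obtain N where N: "N \<in> null_sets lebesgue"
      and dV: "\<And>t. t \<in> space lebesgue - N \<Longrightarrow> t \<in> T \<longrightarrow>
        (\<exists>d. ((\<lambda>s. V (x s)) has_real_derivative d) (at t within T) \<and> d \<le> y2 t \<bullet> u2 t)"
      using AE_E3[OF deriv[OF traj]] by blast
    have "(V \<circ> x) t2 - (V \<circ> x) t1 \<le> integral {t1..t2} (\<lambda>t. y2 t \<bullet> u2 t)"
    proof (rule abs_continuous_on_increment_le_integral[OF t12(3) acV])
      show "(\<lambda>t. y2 t \<bullet> u2 t) integrable_on {t1..t2}"
        using int by (rule set_lebesgue_integral_eq_integral(1))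
      show "negligible N"
        using N by (simp add: negligible_iff_null_sets)
      fix t assume "t \<in> {t1..t2} - N"
      then obtain d where "((V \<circ> x) has_real_derivative d) (at t within T)" "d \<le> y2 t \<bullet> u2 t"
        using dV[of t] T by (auto simp: comp_def)
      then show "\<exists>d. ((V \<circ> x) has_real_derivative d) (at t within {t1..t2}) \<and> d \<le> y2 t \<bullet> u2 t"
        using DERIV_subset T by blast
    qed
    then show "V (x t2) - V (x t1) \<le> integral {t1..t2} (\<lambda>t. y2 t \<bullet> u2 t)"
      by simp
  qed
  show "\<exists>ebar1.
    (\<forall>T x u1 y1 u2 y2.
       ph_trajectory X H J1 J2 R1 R2 G1 G2 T x u1 y1 u2 y2 \<and> (\<forall>t\<in>T. y1 t = ybar1) \<longrightarrow>
         (\<forall>t\<in>T. grad1 H (x t) = ebar1) \<and>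
         (AE t in lebesgue. t \<in> T \<longrightarrow>
            (\<exists>d. ((\<lambda>s. partial_legendre X H ebar1 (snd (x s))) has_real_derivative d) (at t within T) \<and>
                 d \<le> y2 t \<bullet> u2 t))) \<and>
    cyclo_passive (constrained_ph X H J1 J2 R1 R2 G1 G2 ybar1) \<and>
    storage_function (constrained_ph X H J1 J2 R1 R2 G1 G2 ybar1)
      (\<lambda>x. partial_legendre X H ebar1 (snd x))"
  proof (intro exI[of _ ebar] conjI allI impI)
    fix T x u1 y1 u2 y2
    assume "ph_trajectory X H J1 J2 R1 R2 G1 G2 T x u1 y1 u2 y2 \<and> (\<forall>t\<in>T. y1 t = ybar1)"
    then have traj: "ph_trajectory X H J1 J2 R1 R2 G1 G2 T x u1 y1 u2 y2" "\<forall>t\<in>T. y1 t = ybar1"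
      by auto
    show "\<forall>t\<in>T. grad1 H (x t) = ebar"
      using e_const[OF traj] by blast
    show "AE t in lebesgue. t \<in> T \<longrightarrow>
        (\<exists>d. ((\<lambda>s. partial_legendre X H ebar (snd (x s))) has_real_derivative d) (at t within T) \<and>
             d \<le> y2 t \<bullet> u2 t)"
      using deriv[OF traj]
    proof eventually_elim
      case (elim t)
      show ?case
      proof
        assume t: "t \<in> T"
        with elim obtain d where dV: "((\<lambda>s. V (x s)) has_real_derivative d) (at t within T)"
          and d: "d \<le> y2 t \<bullet> u2 t"
          by blast
        \<comment> \<open>The transform along the trajectory equals \<open>V (x s)\<close> at every
          \<open>s\<close> in \<open>T\<close>, and a derivative within \<open>T\<close> sees no
          other points.\<close>
        have "((\<lambda>s. partial_legendre X H ebar (snd (x s))) has_real_derivative d) (at t within T)"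
          unfolding has_field_derivative_def
          by (rule has_derivative_transform[OF t _ dV[unfolded has_field_derivative_def]])
            (rule legendre[OF traj])
        with d show "\<exists>d. ((\<lambda>s. partial_legendre X H ebar (snd (x s))) has_real_derivative d)
            (at t within T) \<and> d \<le> y2 t \<bullet> u2 t"
          by blast
      qed
    qed
  next
    show "cyclo_passive (constrained_ph X H J1 J2 R1 R2 G1 G2 ybar1)"
      unfolding cyclo_passive_def constrained_ph_def
    proof (intro allI impI; elim conjE exE)
      fix T x u y t1 t2 u1 y1
      assume *: "ph_trajectory X H J1 J2 R1 R2 G1 G2 T x u1 y1 u y" "\<forall>t\<in>T. y1 t = ybar1"
        "t1 \<in> T" "t2 \<in> T" "t1 \<le> t2" and "x t1 = x t2"
      \<comment> \<open>Equal end states make the increment of \<open>V\<close> zero in the storage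
        inequality.\<close>
      then show "(\<lambda>t. y t \<bullet> u t) absolutely_integrable_on {t1..t2} \<and>
          0 \<le> integral {t1..t2} (\<lambda>t. y t \<bullet> u t)"
        using storage[OF *] by simp
    qed
    show "storage_function (constrained_ph X H J1 J2 R1 R2 G1 G2 ybar1)
      (\<lambda>x. partial_legendre X H ebar (snd x))"
      unfolding storage_function_def constrained_ph_def
    proof (intro allI impI; elim conjE exE)
      fix T x u y t1 t2 u1 y1
      assume *: "ph_trajectory X H J1 J2 R1 R2 G1 G2 T x u1 y1 u y" "\<forall>t\<in>T. y1 t = ybar1"
        "t1 \<in> T" "t2 \<in> T" "t1 \<le> t2"
      then show "(\<lambda>t. y t \<bullet> u t) absolutely_integrable_on {t1..t2} \<and>
          partial_legendre X H ebar (snd (x t2)) - partial_legendre X H ebar (snd (x t1))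
            \<le> integral {t1..t2} (\<lambda>t. y t \<bullet> u t)"
        using storage[OF *] legendre[OF *(1,2)] by simp
    qed
  qed
qed

end
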